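(* Let $(E,\mathcal{C},r_{\mathcal{C}})$ be a semimatroid and $\bm x=\{x_e\}_{e\in E}$, $\bm y=\{y_e\}_{e\in E}$ indeterminates. Then \[ Z(\mathcal{C};\xi,\bm x\bm y)=\sum_{T\in\mathcal{C}}\xi^{-r_\mathcal{C}(T)}\bm y^T(\bm x+1)^TZ(\mathcal{C}/T;\xi,-\bm y). \]
   Context: A semimatroid is a triple $(E,\mathcal{C},r_{\mathcal{C}})$ where $E$ is a finite set, $\mathcal{C}$ is a nonempty simplicial complex on $E$, and $r_{\mathcal{C}}:\mathcal{C}\to\mathbb{N}$ satisfies: (SR1) $0\le r_{\mathcal{C}}(X)\le |X|$; (SR2) $X\subseteq Y$ in $\mathcal{C}$ implies $r_{\mathcal{C}}(X)\le r_{\mathcal{C}}(Y)$; (SR3) if $X,Y,X\cup Y\in\mathcal{C}$ then $r_{\mathcal{C}}(X\cap Y)+r_{\mathcal{C}}(X\cup Y)\le r_{\mathcal{C}}(X)+r_{\mathcal{C}}(Y)$; (SR4) if $X,Y\in\mathcal{C}$ and $r_{\mathcal{C}}(X)=r_{\mathcal{C}}(X\cap Y)$ then $X\cup Y\in\mathcal{C}$; (SR5) if $X,Y\in\mathcal{C}$ and $r_{\mathcal{C}}(X)<r_{\mathcal{C}}(Y)$ then $X\cup\{e\}\in\mathcal{C}$ for some $e\in Y-X$. For $T\in\mathcal{C}$, $\mathcal{C}/T$ is the semimatroid on $E-T$ with central sets $\{Y\subseteq E-T: Y\cup T\in\mathcal{C}\}$ and rank $r_{\mathcal{C}}(Y\cup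 T)-r_{\mathcal{C}}(T)$. For a semimatroid $\mathcal{D}$ on ground set $S$ and variables $\bm z$ indexed by a superset of $S$, $Z(\mathcal{D};\lambda,\bm z)=\sum_{A\in\mathcal{D}}\lambda^{-r_{\mathcal{D}}(A)}\prod_{e\in A}z_e$. Notation: $\bm y^T=\prod_{e\in T}y_e$, $(\bm x+1)^T=\prod_{e\in T}(x_e+1)$, $(\bm x\bm y)^A=\prod_{e\in A}x_ey_e$, $-\bm y=\{-y_e\}$. *)

theory Defs
  imports Main
begin

record 'e semimat =
  ground :: "'e set"
  central :: "'e set set"
  rank :: "'e set \<Rightarrow> nat"

text \<open>The rank function is only meaningful on the complex of central sets; its values on other
  sets are arbitrary and never constrained. Singletons of the ground set need not be central.
  The inequality \<open>0 \<le> rank M X\<close> of (SR1) is built into the type \<open>nat\<close>.\<close>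

locale semimatroid =
  fixes M :: "'e semimat"
  assumes finite_ground: "finite (ground M)"
    and central_subset: "X \<in> central M \<Longrightarrow> X \<subseteq> ground M"
    and central_nonempty: "central M \<noteq> {}"
    and central_down: "X \<in> central M \<Longrightarrow> Y \<subseteq> X \<Longrightarrow> Y \<in> central M"
    and SR1: "X \<in> central M \<Longrightarrow> rank M X \<le> card X"
    and SR2: "X \<in> central M \<Longrightarrow> Y \<in> central M \<Longrightarrow> X \<subseteq> Y \<Longrightarrow> rank M X \<le> rank M Y"
    and SR3: "X \<in> central M \<Longrightarrow> Y \<in> central M \<Longrightarrow> X \<union> Y \<in> central M \<Longrightarrow>
      rank M (X \<inter> Y) + rank M (X \<union> Y) \<le> rank M X + rank M Y"
    and SR4: "X \<in> central M \<Longrightarrow> Y \<in> central M \<Longrightarrow> rank M X = rank M (X \<inter> Y) \<Longrightarrow>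
      X \<union> Y \<in> central M"
    and SR5: "X \<in> central M \<Longrightarrow> Y \<in> central M \<Longrightarrow> rank M X < rank M Y \<Longrightarrow>
      \<exists>e\<in>Y - X. X \<union> {e} \<in> central M"

text \<open>The subtraction of naturals in the rank never truncates on central sets of the
  contraction, see \<open>rank_contract_add\<close>.\<close>

definition contract :: "'e semimat \<Rightarrow> 'e set \<Rightarrow> 'e semimat" where
  "contract M T = \<lparr>ground = ground M - T,
                   central = {Y. Y \<subseteq> ground M - T \<and> Y \<union> T \<in> central M},
                   rank = (\<lambda>Y. rank M (Y \<union> T) - rank M T)\<rparr>"

text \<open>The inverse of a unit of a commutative ring, where it is unique; unspecified on
  non-units.\<close>

definition unit_inv :: "'r::comm_ring_1 \<Rightarrow> 'r" where
  "unit_inv u = (THE v. u * v = 1)"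

text \<open>The polynomial \<open>Z\<close>, with its variables taking values in a commutative ring in which
  \<open>l\<close> is a unit. The ring may be the ring of Laurent polynomials over the integers (for instance
  \<open>('v \<Rightarrow>\<^sub>0 int) \<Rightarrow>\<^sub>0 int\<close> of theory \<open>Poly_Mapping\<close>), and \<open>l\<close> and the \<open>z e\<close> elements built from
  its indeterminates, so an identity over all such rings includes the one for indeterminates.\<close>

definition Z :: "'e semimat \<Rightarrow> 'r::comm_ring_1 \<Rightarrow> ('e \<Rightarrow> 'r) \<Rightarrow> 'r" where
  "Z D l z = (\<Sum>A\<in>central D. unit_inv l ^ rank D A * (\<Prod>e\<in>A. z e))"

lemma unit_inv_right:
  fixes u :: "'r::comm_ring_1"
  assumes "u dvd 1"
  shows "u * unit_inv u = 1"
proof -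
  obtain v where v: "u * v = 1" using assms by (metis dvdE)
  have "w = v" if "u * w = 1" for w
    using v that by (metis mult.assoc mult.commute mult_1_left)
  then show ?thesis unfolding unit_inv_def using v by (metis (mono_tags, lifting) theI)
qed

lemma (in semimatroid) rank_contract_add:
  assumes "Y \<in> central (contract M T)"
  shows "rank (contract M T) Y + rank M T = rank M (Y \<union> T)"
proof -
  have YT: "Y \<union> T \<in> central M" using assms by (simp add: contract_def)
  then have "T \<in> central M" by (rule central_down) simp
  with YT have "rank M T \<le> rank M (Y \<union> T)" by (intro SR2) auto
  then show ?thesis by (simp add: contract_def)
qed

lemma (in semimatroid) semimatroid_contract:
  assumes T: "T \<in> central M"
  shows "semimatroid (contract M T)"
proof -
  let ?N = "contract M T"
  have cen: "Y \<in> central ?N \<longleftrightarrow> Y \<subseteq> ground M - T \<and> Y \<union> T \<in> central M" for Y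
    by (simp add: contract_def)
  have rk: "rank ?N Y + rank M T = rank M (Y \<union> T)" if "Y \<in> central ?N" for Y
    using that by (rule rank_contract_add)
  have down: "Y \<in> central ?N" if "X \<in> central ?N" "Y \<subseteq> X" for X Y
    using that central_down[of "X \<union> T" "Y \<union> T"] by (auto simp: cen)
  have un: "(X \<union> T) \<union> (Y \<union> T) = (X \<union> Y) \<union> T" and int: "(X \<union> T) \<inter> (Y \<union> T) = (X \<inter> Y) \<union> T" for X Y
    by auto
  show ?thesis
  proof
    show "finite (ground ?N)" using finite_ground by (simp add: contract_def)
    show "X \<subseteq> ground ?N" if "X \<in> central ?N" for X using that by (simp add: contract_def)
    have "{} \<in> central ?N" using T by (simp add: cen)
    then show "central ?N \<noteq> {}" by blast
    show "Y \<in> central ?N" if "X \<in> central ?N" "Y \<subseteq> X" for X Y using down that .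
    show "rank ?N X \<le> card X" if X: "X \<in> central ?N" for X
    proof -
      have XT: "X \<union> T \<in> central M" and disj: "X \<inter> T = {}" using X by (auto simp: cen)
      have X': "X \<in> central M" using XT by (rule central_down) simp
      have "rank M (X \<inter> T) + rank M (X \<union> T) \<le> rank M X + rank M T" using X' T XT by (rule SR3)
      then show ?thesis using rk[OF X] SR1[OF X'] by linarith
    qed
    show "rank ?N X \<le> rank ?N Y" if "X \<in> central ?N" "Y \<in> central ?N" "X \<subseteq> Y" for X Y
      using rk[OF that(1)] rk[OF that(2)] SR2[of "X \<union> T" "Y \<union> T"] that by (fastforce simp: cen)
    show "rank ?N (X \<inter> Y) + rank ?N (X \<union> Y) \<le> rank ?N X + rank ?N Y"
      if "X \<in> central ?N" "Y \<in> central ?N" "X \<union> Y \<in> central ?N" for X Y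
    proof -
      have "X \<inter> Y \<in> central ?N" using that(1) by (rule down) simp
      moreover have "rank M ((X \<inter> Y) \<union> T) + rank M ((X \<union> Y) \<union> T) \<le> rank M (X \<union> T) + rank M (Y \<union> T)"
        using SR3[of "X \<union> T" "Y \<union> T"] that unfolding un int by (simp add: cen)
      ultimately show ?thesis using rk that by (smt (verit) add.assoc add.commute add_le_cancel_right)
    qed
    show "X \<union> Y \<in> central ?N"
      if "X \<in> central ?N" "Y \<in> central ?N" "rank ?N X = rank ?N (X \<inter> Y)" for X Y
    proof -
      have "X \<inter> Y \<in> central ?N" using that(1) by (rule down) simp
      then have "rank M (X \<union> T) = rank M ((X \<inter> Y) \<union> T)" using rk that by metis
      then show ?thesis using SR4[of "X \<union> T" "Y \<union> T"] that unfolding un int by (simp add: cen)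
    qed
    show "\<exists>e\<in>Y - X. X \<union> {e} \<in> central ?N"
      if "X \<in> central ?N" "Y \<in> central ?N" "rank ?N X < rank ?N Y" for X Y
    proof -
      have "rank M (X \<union> T) < rank M (Y \<union> T)" using rk[OF that(1)] rk[OF that(2)] that(3) by linarith
      then have "\<exists>e\<in>(Y \<union> T) - (X \<union> T). (X \<union> T) \<union> {e} \<in> central M"
        using that by (intro SR5) (simp_all add: cen)
      then obtain e where "e \<in> (Y \<union> T) - (X \<union> T)" "(X \<union> T) \<union> {e} \<in> central M" by blast
      moreover from this have "e \<in> ground M" using that by (auto simp: cen)
      ultimately show ?thesis using that by (intro bexI[of _ e]) (auto simp: cen)
    qed
  qed
qed

end

theory Submission imports Defs begin

text \<open>Writing \<open>x y = y (x + 1) - y\<close> and expanding the product over a central set \<open>A\<close> gives a sum over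
  the subsets \<open>T\<close> of \<open>A\<close>. Pairs \<open>T \<subseteq> A\<close> with \<open>A\<close> central correspond to pairs of a central set \<open>T\<close> and a
  central set \<open>A - T\<close> of the contraction by \<open>T\<close>, and the ranks of these add up to the rank of \<open>A\<close>.\<close>

lemma (in semimatroid) sum_central_subsets:
  fixes f :: "'e set \<Rightarrow> 'e set \<Rightarrow> 'r::comm_monoid_add"
  shows "(\<Sum>A\<in>central M. \<Sum>T\<in>Pow A. f T (A - T)) =
    (\<Sum>T\<in>central M. \<Sum>Y\<in>central (contract M T). f T Y)"
proof -
  have fin: "finite (central M)"
    using central_subset finite_ground by (auto intro!: finite_subset[of _ "Pow (ground M)"])
  have finA: "finite A" if "A \<in> central M" for A
    using central_subset[OF that] finite_ground by (rule finite_subset)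
  have finC: "finite (central (contract M T))" for T
    using finite_ground by (auto simp: contract_def intro!: finite_subset[of _ "Pow (ground M)"])
  have "(\<Sum>A\<in>central M. \<Sum>T\<in>Pow A. f T (A - T)) =
      (\<Sum>(A, T)\<in>(SIGMA A:central M. Pow A). f T (A - T))"
    using fin finA by (intro sum.Sigma) auto
  also have "\<dots> = (\<Sum>(T, Y)\<in>(SIGMA T:central M. central (contract M T)). f T Y)"
    \<comment> \<open>The maps are mutually inverse since \<open>T\<close> lies in \<open>A\<close>
      and a central \<open>Y\<close> of the contraction is disjoint from \<open>T\<close>. Closure
      under subsets makes \<open>T\<close> central.\<close>
    by (rule sum.reindex_bij_witness[where i = "\<lambda>(T, Y). (Y \<union> T, T)" and j = "\<lambda>(A, T). (T, A - T)"])
      (auto simp: contract_def Un_absorb2 intro: central_down dest: central_subset)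
  also have "\<dots> = (\<Sum>T\<in>central M. \<Sum>Y\<in>central (contract M T). f T Y)"
    using fin finC by (intro sum.Sigma[symmetric]) auto
  finally show ?thesis .
qed

theorem theorem2p10:
  fixes M :: "'e semimat"
    and xi :: "'r::comm_ring_1"
    and x y :: "'e \<Rightarrow> 'r"
  assumes "semimatroid M"
    and "xi dvd 1"
  shows "Z M xi (\<lambda>e. x e * y e) =
    (\<Sum>T\<in>central M. unit_inv xi ^ rank M T * (\<Prod>e\<in>T. y e) * (\<Prod>e\<in>T. x e + 1)
       * Z (contract M T) xi (\<lambda>e. - y e))"
proof -
  interpret semimatroid M by fact
  \<comment> \<open>The exponent is the rank of \<open>Y \<union> T\<close>, so that the summand
    depends on \<open>T\<close> and \<open>Y\<close> alone; for \<open>Y = A - T\<close> the union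
    is \<open>A\<close> again.\<close>
  let ?f = "\<lambda>T Y. unit_inv xi ^ rank M (Y \<union> T) *
    ((\<Prod>e\<in>T. y e * (x e + 1)) * (\<Prod>e\<in>Y. - y e))"
  have "unit_inv xi ^ rank M A * (\<Prod>e\<in>A. x e * y e) = (\<Sum>T\<in>Pow A. ?f T (A - T))"
    if A: "A \<in> central M" for A
  proof -
    have "finite A" using central_subset[OF A] finite_ground by (rule finite_subset)
    have "(\<Prod>e\<in>A. x e * y e) = (\<Prod>e\<in>A. y e * (x e + 1) + - y e)"
      by (simp add: algebra_simps)
    also have "\<dots> = (\<Sum>T\<in>Pow A. (\<Prod>e\<in>T. y e * (x e + 1)) * (\<Prod>e\<in>A - T. - y e))"
      using \<open>finite A\<close> by (rule prod_add)
    finally show ?thesis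
      by (auto simp: sum_distrib_left Un_absorb2 intro!: sum.cong)
  qed
  then have "Z M xi (\<lambda>e. x e * y e) = (\<Sum>A\<in>central M. \<Sum>T\<in>Pow A. ?f T (A - T))"
    unfolding Z_def by (rule sum.cong[OF refl])
  also have "\<dots> = (\<Sum>T\<in>central M. \<Sum>Y\<in>central (contract M T). ?f T Y)"
    by (rule sum_central_subsets)
  \<comment> \<open>As \<open>rank M (Y \<union> T)\<close> is the rank of \<open>Y\<close> in the
    contraction plus \<open>rank M T\<close>, the power splits and all factors in \<open>T\<close>
    leave the inner sum.\<close>
  also have "\<dots> = (\<Sum>T\<in>central M. unit_inv xi ^ rank M T * (\<Prod>e\<in>T. y e) * (\<Prod>e\<in>T. x e + 1)
       * Z (contract M T) xi (\<lambda>e. - y e))"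
    unfolding Z_def sum_distrib_left
    by (intro sum.cong refl)
      (simp add: rank_contract_add[symmetric] power_add prod.distrib mult_ac)
  finally show ?thesis .
qed

end
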